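(* Let $(\mathcal{H},\Gamma_0,\Gamma_1)$ be a boundary triplet of $S^*$ which is compatible with the Clifford algebra $\mathcal{C}l_2(J,R)$ (as defined in the context), and let $\vec{\alpha}\in\mathbb{S}^2$ be arbitrary. Then the operators $A\in\Sigma_{J_{\vec{\alpha}}}$ coincide with the restrictions of $S^*$ onto the domains $$\mathcal{D}(A)=\{f\in\mathcal{D}(S^* ): U(\mathcal{J}_{\vec{\alpha}}\Gamma_1+i\Gamma_0)f=(\mathcal{J}_{\vec{\alpha}}\Gamma_1-i\Gamma_0)f\},$$ where $U$ runs over the set of unitary operators in $\mathcal{H}$. The correspondence $A\leftrightarrow U$ so determined is a bijection between the set $\Sigma_{J_{\vec{\alpha}}}$ of all $J_{\vec{\alpha}}$-self-adjoint extensions of $S$ and the set of unitary operators in $\mathcal{H}$.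
   Context: $\mathfrak{H}$ is a complex Hilbert space. A fundamental symmetry is a bounded operator $K$ with $K=K^*$, $K^2=I$; it is non-trivial if $K\neq\pm I$. $J$ and $R$ are fixed non-trivial fundamental symmetries in $\mathfrak{H}$ with $JR=-RJ$; $\mathcal{C}l_2(J,R)=\mathrm{span}\{I,J,R,iJR\}$. For $\vec{\alpha}=(\alpha_1,\alpha_2,\alpha_3)\in\mathbb{S}^2\subset\mathbb{R}^3$ put $J_{\vec{\alpha}}=\alpha_1J+\alpha_2R+\alpha_3\,iJR$, a non-trivial fundamental symmetry. $S$ is a closed densely defined symmetric operator in $\mathfrak{H}$ with equal deficiency indices such that $SJ=JS$ and $SR=RS$. $\Sigma_{J_{\vec{\alpha}}}=\{A\supset S: J_{\vec{\alpha}}A^*=AJ_{\vec{\alpha}}\}$. A boundary triplet of $S^*$ is $(\mathcal{H},\Gamma_0,\Gamma_1)$ with $\mathcal{H}$ a Hilbert space and $\Gamma_0,\Gamma_1:\mathcal{D}(S^* )\to\mathcal{H}$ linear, such that $(S^*x,y)-(x,S^*y)=(\Gamma_1x,\Gamma_0y)_{\mathcal{H}}-(\Gamma_0x,\Gamma_1y)_{\mathcal{H}}$ for all $x,y\in\mathcal{D}(S^* )$ and $(\Gamma_0,\Gamma_1):\mathcal{D}(S^* )\to\mathcal{H}\oplus\mathcal{H}$ is surjective. The boundary triplet is called compatible if, for some fixed anti-commuting $J_{\vec{\tau}},J_{\vec{\kappa}}\in\mathcal{C}l_2(J,R)$ ($\vec{\tau},\vec{\kappa}\in\mathbb{S}^2$),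 the formulas $\mathcal{J}_{\vec{\tau}}\Gamma_j=\Gamma_jJ_{\vec{\tau}}$, $\mathcal{J}_{\vec{\kappa}}\Gamma_j=\Gamma_jJ_{\vec{\kappa}}$ ($j=0,1$, on $\mathcal{D}(S^* )$) correctly define anti-commuting fundamental symmetries $\mathcal{J}_{\vec{\tau}},\mathcal{J}_{\vec{\kappa}}$ in $\mathcal{H}$. Then there are anti-commuting fundamental symmetries $\mathcal{J},\mathcal{R}$ in $\mathcal{H}$ with $\mathcal{J}\Gamma_j=\Gamma_jJ$, $\mathcal{R}\Gamma_j=\Gamma_jR$, and for every $\vec{\alpha}\in\mathbb{S}^2$ the fundamental symmetry $\mathcal{J}_{\vec{\alpha}}=\alpha_1\mathcal{J}+\alpha_2\mathcal{R}+\alpha_3\,i\mathcal{J}\mathcal{R}$ in $\mathcal{H}$ satisfies $\mathcal{J}_{\vec{\alpha}}\Gamma_j=\Gamma_jJ_{\vec{\alpha}}$, $j=0,1$. *)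

theory Defs
  imports "HOL-Analysis.Analysis"
begin

section \<open>Complex Hilbert spaces\<close>

text \<open>
  The inner product is linear in the first argument. The axiom \<open>cinner_self\<close> forces the norm of
  the underlying Banach space to be the Hilbert norm, hence also positive definiteness.
\<close>

class complex_hilbert = banach +
  fixes scaleC :: "complex \<Rightarrow> 'a \<Rightarrow> 'a" (infixr "*\<^sub>C" 75)
    and cinner :: "'a \<Rightarrow> 'a \<Rightarrow> complex"
  assumes scaleC_add_right: "c *\<^sub>C (x + y) = c *\<^sub>C x + c *\<^sub>C y"
    and scaleC_add_left: "(c + d) *\<^sub>C x = c *\<^sub>C x + d *\<^sub>C x"
    and scaleC_scaleC: "c *\<^sub>C d *\<^sub>C x = (c * d) *\<^sub>C x"
    and scaleR_scaleC: "r *\<^sub>R x = complex_of_real r *\<^sub>C x"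
    and cinner_commute: "cinner x y = cnj (cinner y x)"
    and cinner_add_left: "cinner (x + y) z = cinner x z + cinner y z"
    and cinner_scaleC_left: "cinner (c *\<^sub>C x) y = c * cinner x y"
    and cinner_self: "cinner x x = complex_of_real ((norm x)\<^sup>2)"

global_interpretation complex_vector: vector_space "scaleC :: complex \<Rightarrow> 'a \<Rightarrow> 'a::complex_hilbert"
proof
  fix x :: 'a
  show "1 *\<^sub>C x = x"
    using scaleR_scaleC [of 1 x] by simp
qed (fact scaleC_add_right scaleC_add_left scaleC_scaleC)+

instantiation complex :: complex_hilbert
begin

definition scaleC_complex :: "complex \<Rightarrow> complex \<Rightarrow> complex" where
  "scaleC_complex c x = c * x"

definition cinner_complex :: "complex \<Rightarrow> complex \<Rightarrow> complex" where
  "cinner_complex x y = x * cnj y"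

instance
proof
  fix c d x y z :: complex and r :: real
  show "c *\<^sub>C (x + y) = c *\<^sub>C x + c *\<^sub>C y" "(c + d) *\<^sub>C x = c *\<^sub>C x + d *\<^sub>C x"
    "c *\<^sub>C d *\<^sub>C x = (c * d) *\<^sub>C x" "r *\<^sub>R x = complex_of_real r *\<^sub>C x"
    by (simp_all add: scaleC_complex_def distrib_left distrib_right scaleR_conv_of_real)
  show "cinner (x + y) z = cinner x z + cinner y z" "cinner (c *\<^sub>C x) y = c * cinner x y"
    "cinner x y = cnj (cinner y x)"
    by (simp_all add: scaleC_complex_def cinner_complex_def distrib_right)
  show "cinner x x = complex_of_real ((norm x)\<^sup>2)"
    unfolding cinner_complex_def by (rule complex_norm_square [symmetric])
qed

end

section \<open>Everywhere defined operators\<close>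

definition bounded_clinear :: "('a::complex_hilbert \<Rightarrow> 'b::complex_hilbert) \<Rightarrow> bool" where
  "bounded_clinear F \<longleftrightarrow> bounded_linear F \<and> (\<forall>c x. F (c *\<^sub>C x) = c *\<^sub>C F x)"

definition unitary :: "('a::complex_hilbert \<Rightarrow> 'a) \<Rightarrow> bool" where
  "unitary U \<longleftrightarrow> bounded_clinear U \<and> surj U \<and> (\<forall>x y. cinner (U x) (U y) = cinner x y)"

definition fundamental_symmetry :: "('a::complex_hilbert \<Rightarrow> 'a) \<Rightarrow> bool" where
  "fundamental_symmetry K \<longleftrightarrow> bounded_clinear K \<and>
     (\<forall>x y. cinner (K x) y = cinner x (K y)) \<and> (\<forall>x. K (K x) = x)"

definition nontrivial_fundamental_symmetry :: "('a::complex_hilbert \<Rightarrow> 'a) \<Rightarrow> bool" where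
  "nontrivial_fundamental_symmetry K \<longleftrightarrow>
     fundamental_symmetry K \<and> K \<noteq> (\<lambda>x. x) \<and> K \<noteq> (\<lambda>x. - x)"

definition anticommute :: "('a::complex_hilbert \<Rightarrow> 'a) \<Rightarrow> ('a \<Rightarrow> 'a) \<Rightarrow> bool" where
  "anticommute F G \<longleftrightarrow> (\<forall>x. F (G x) = - G (F x))"

definition clifford :: "('a::complex_hilbert \<Rightarrow> 'a) \<Rightarrow> ('a \<Rightarrow> 'a) \<Rightarrow> real^3 \<Rightarrow> 'a \<Rightarrow> 'a" where
  "clifford J R \<alpha> x = (\<alpha> $ 1) *\<^sub>R J x + (\<alpha> $ 2) *\<^sub>R R x + (\<alpha> $ 3) *\<^sub>R (\<i> *\<^sub>C J (R x))"

section \<open>Unbounded operators\<close>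

text \<open>
  An operator with a domain is represented by its graph, so that its domain is \<open>Domain T\<close>,
  extension of operators is inclusion, and equality of operators includes equality of domains.
\<close>

type_synonym 'a graph = "('a \<times> 'a) set"

definition linear_operator :: "'a::complex_hilbert graph \<Rightarrow> bool" where
  "linear_operator T \<longleftrightarrow> single_valued T \<and> (0, 0) \<in> T \<and>
     (\<forall>x x' y y'. (x, x') \<in> T \<longrightarrow> (y, y') \<in> T \<longrightarrow> (x + y, x' + y') \<in> T) \<and>
     (\<forall>c x x'. (x, x') \<in> T \<longrightarrow> (c *\<^sub>C x, c *\<^sub>C x') \<in> T)"

definition graph_of :: "('a \<Rightarrow> 'a) \<Rightarrow> 'a graph" where
  "graph_of F = {(x, y). y = F x}"

text \<open>
  The product \<open>A \<odot> B\<close> applies \<open>B\<close> first; its domain consists of the \<open>x\<close> in the domain of \<open>B\<close> with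
  \<open>B x\<close> in the domain of \<open>A\<close>. Note that \<open>(O)\<close> composes relations in the opposite order.
\<close>

definition op_prod :: "'a graph \<Rightarrow> 'a graph \<Rightarrow> 'a graph" (infixl "\<odot>" 75) where
  "A \<odot> B = B O A"

definition densely_defined :: "'a::complex_hilbert graph \<Rightarrow> bool" where
  "densely_defined T \<longleftrightarrow> closure (Domain T) = UNIV"

definition symmetric_operator :: "'a::complex_hilbert graph \<Rightarrow> bool" where
  "symmetric_operator T \<longleftrightarrow>
     (\<forall>x x' y y'. (x, x') \<in> T \<longrightarrow> (y, y') \<in> T \<longrightarrow> cinner x' y = cinner x y')"

text \<open>For a densely defined operator this relation is single-valued, and is the usual adjoint.\<close>

definition adj :: "'a::complex_hilbert graph \<Rightarrow> 'a graph" where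
  "adj T = {(y, z). \<forall>(x, x') \<in> T. cinner x' y = cinner x z}"

section \<open>Deficiency indices\<close>

definition orthonormal_basis :: "'a::complex_hilbert set \<Rightarrow> 'a set \<Rightarrow> bool" where
  "orthonormal_basis M B \<longleftrightarrow>
     (\<forall>x\<in>B. \<forall>y\<in>B. cinner x y = (if x = y then 1 else 0)) \<and>
     closure (complex_vector.span B) = M"

text \<open>
  The Hilbert space dimension of a closed subspace, as a cardinal. All orthonormal bases of \<open>M\<close>
  are equipotent, so up to \<open>ordIso\<close> (equality of cardinals) the choice does not matter.
\<close>

definition hilbert_dim :: "'a::complex_hilbert set \<Rightarrow> 'a rel" where
  "hilbert_dim M = card_of (SOME B. orthonormal_basis M B)"

definition deficiency_space :: "'a::complex_hilbert graph \<Rightarrow> complex \<Rightarrow> 'a set" where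
  "deficiency_space S z = {x. (x, z *\<^sub>C x) \<in> adj S}"

definition equal_deficiency_indices :: "'a::complex_hilbert graph \<Rightarrow> bool" where
  "equal_deficiency_indices S \<longleftrightarrow>
     (hilbert_dim (deficiency_space S \<i>), hilbert_dim (deficiency_space S (- \<i>))) \<in> ordIso"

section \<open>Self-adjointness in the Krein space sense\<close>

definition selfadjoint_extensions ::
    "'a::complex_hilbert graph \<Rightarrow> ('a \<Rightarrow> 'a) \<Rightarrow> 'a graph set" where
  "selfadjoint_extensions S K =
     {A. linear_operator A \<and> S \<subseteq> A \<and> graph_of K \<odot> adj A = A \<odot> graph_of K}"

section \<open>Boundary triplets\<close>

text \<open>
  The boundary maps are total functions; only their values on the domain of \<open>adj S\<close> matter. The
  auxiliary space is the type \<open>'h\<close>.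
\<close>

definition clinear_on :: "'a::complex_hilbert set \<Rightarrow> ('a \<Rightarrow> 'h::complex_hilbert) \<Rightarrow> bool" where
  "clinear_on D \<Gamma> \<longleftrightarrow> (\<forall>x\<in>D. \<forall>y\<in>D. \<Gamma> (x + y) = \<Gamma> x + \<Gamma> y) \<and>
     (\<forall>c. \<forall>x\<in>D. \<Gamma> (c *\<^sub>C x) = c *\<^sub>C \<Gamma> x)"

definition boundary_triplet ::
    "'a::complex_hilbert graph \<Rightarrow> ('a \<Rightarrow> 'h::complex_hilbert) \<Rightarrow> ('a \<Rightarrow> 'h) \<Rightarrow> bool" where
  "boundary_triplet S \<Gamma>\<^sub>0 \<Gamma>\<^sub>1 \<longleftrightarrow>
     clinear_on (Domain (adj S)) \<Gamma>\<^sub>0 \<and> clinear_on (Domain (adj S)) \<Gamma>\<^sub>1 \<and>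
     (\<forall>x x' y y'. (x, x') \<in> adj S \<longrightarrow> (y, y') \<in> adj S \<longrightarrow>
        cinner x' y - cinner x y' = cinner (\<Gamma>\<^sub>1 x) (\<Gamma>\<^sub>0 y) - cinner (\<Gamma>\<^sub>0 x) (\<Gamma>\<^sub>1 y)) \<and>
     (\<lambda>f. (\<Gamma>\<^sub>0 f, \<Gamma>\<^sub>1 f)) ` Domain (adj S) = UNIV"

definition intertwines ::
    "'a::complex_hilbert graph \<Rightarrow> ('a \<Rightarrow> 'h::complex_hilbert) \<Rightarrow> ('a \<Rightarrow> 'h) \<Rightarrow>
      ('h \<Rightarrow> 'h) \<Rightarrow> ('a \<Rightarrow> 'a) \<Rightarrow> bool" where
  "intertwines S \<Gamma>\<^sub>0 \<Gamma>\<^sub>1 L K \<longleftrightarrow>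
     (\<forall>f\<in>Domain (adj S). L (\<Gamma>\<^sub>0 f) = \<Gamma>\<^sub>0 (K f) \<and> L (\<Gamma>\<^sub>1 f) = \<Gamma>\<^sub>1 (K f))"

text \<open>
  Since \<open>\<Gamma>\<^sub>0\<close> and \<open>\<Gamma>\<^sub>1\<close> are onto, there is at most one \<open>L\<close> intertwining with a given \<open>K\<close>.
\<close>

definition induced_symmetries ::
    "'a::complex_hilbert graph \<Rightarrow> ('a \<Rightarrow> 'h::complex_hilbert) \<Rightarrow> ('a \<Rightarrow> 'h) \<Rightarrow>
      ('a \<Rightarrow> 'a) \<Rightarrow> ('a \<Rightarrow> 'a) \<Rightarrow> ('h \<Rightarrow> 'h) \<Rightarrow> ('h \<Rightarrow> 'h) \<Rightarrow> bool" where
  "induced_symmetries S \<Gamma>\<^sub>0 \<Gamma>\<^sub>1 K K' L L' \<longleftrightarrow>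
     fundamental_symmetry L \<and> fundamental_symmetry L' \<and> anticommute L L' \<and>
     intertwines S \<Gamma>\<^sub>0 \<Gamma>\<^sub>1 L K \<and> intertwines S \<Gamma>\<^sub>0 \<Gamma>\<^sub>1 L' K'"

definition clifford_compatible ::
    "('a::complex_hilbert \<Rightarrow> 'a) \<Rightarrow> ('a \<Rightarrow> 'a) \<Rightarrow> 'a graph \<Rightarrow>
      ('a \<Rightarrow> 'h::complex_hilbert) \<Rightarrow> ('a \<Rightarrow> 'h) \<Rightarrow> bool" where
  "clifford_compatible J R S \<Gamma>\<^sub>0 \<Gamma>\<^sub>1 \<longleftrightarrow>
     (\<exists>\<tau>\<in>sphere 0 1. \<exists>\<kappa>\<in>sphere 0 1. anticommute (clifford J R \<tau>) (clifford J R \<kappa>) \<and>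
        (\<exists>L L'. induced_symmetries S \<Gamma>\<^sub>0 \<Gamma>\<^sub>1 (clifford J R \<tau>) (clifford J R \<kappa>) L L'))"

definition boundary_restriction ::
    "'a::complex_hilbert graph \<Rightarrow> ('a \<Rightarrow> 'h::complex_hilbert) \<Rightarrow> ('a \<Rightarrow> 'h) \<Rightarrow>
      ('h \<Rightarrow> 'h) \<Rightarrow> ('h \<Rightarrow> 'h) \<Rightarrow> 'a graph" where
  "boundary_restriction S \<Gamma>\<^sub>0 \<Gamma>\<^sub>1 L U =
     {(f, g) \<in> adj S. U (L (\<Gamma>\<^sub>1 f) + \<i> *\<^sub>C \<Gamma>\<^sub>0 f) = L (\<Gamma>\<^sub>1 f) - \<i> *\<^sub>C \<Gamma>\<^sub>0 f}"

end

theory Submission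
  imports Defs "HOL-Analysis.Cross3"
begin

text \<open>
  Write \<open>P = L \<Gamma>\<^sub>1 + i \<Gamma>\<^sub>0\<close> and \<open>M = L \<Gamma>\<^sub>1 - i \<Gamma>\<^sub>0\<close>, where \<open>L\<close> is the fundamental symmetry
  intertwined with \<open>K = J\<^sub>\<alpha>\<close>. Green's identity, twisted by \<open>K\<close>, becomes
  \<open>(S\<^sup>* x, K y) - (x, K S\<^sup>* y) = (i / 2) ((P x, P y) - (M x, M y))\<close>, and \<open>(P, M)\<close> is onto. Hence an
  intermediate extension \<open>A\<close> is self-adjoint in the Krein sense iff the relation
  \<open>C = {(P f, M f) | f \<in> D(A)}\<close> coincides with
  \<open>{(a, b) | (a, c) = (b, d) for all (c, d) \<in> C}\<close> and determines \<open>A\<close>. Relations with that property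
  are exactly the graphs of unitary operators.
\<close>

section \<open>Complex Hilbert spaces\<close>

lemma cinner_add_right: "cinner x (y + z) = cinner x y + cinner x (z::'a::complex_hilbert)"
  by (metis cinner_add_left cinner_commute complex_cnj_add)

lemma cinner_scaleC_right: "cinner x (c *\<^sub>C y) = cnj c * cinner x (y::'a::complex_hilbert)"
  by (metis cinner_commute cinner_scaleC_left complex_cnj_mult)

lemma scaleC_minus_one: "(-1) *\<^sub>C x = - (x::'a::complex_hilbert)"
  by simp

lemma cinner_minus_left: "cinner (- x) y = - cinner x (y::'a::complex_hilbert)"
  by (metis cinner_scaleC_left mult_minus1 scaleC_minus_one)

lemma cinner_minus_right: "cinner x (- y) = - cinner x (y::'a::complex_hilbert)"
  by (metis cinner_commute cinner_minus_left complex_cnj_minus)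

lemma cinner_diff_left: "cinner (x - y) z = cinner x z - cinner y (z::'a::complex_hilbert)"
  using cinner_add_left [of x "- y" z] by (simp add: cinner_minus_left)

lemma cinner_diff_right: "cinner x (y - z) = cinner x y - cinner x (z::'a::complex_hilbert)"
  using cinner_add_right [of x y "- z"] by (simp add: cinner_minus_right)

lemma cinner_zero_left [simp]: "cinner 0 (x::'a::complex_hilbert) = 0"
  using cinner_diff_left [of 0 0 x] by simp

lemma cinner_zero_right [simp]: "cinner (x::'a::complex_hilbert) 0 = 0"
  using cinner_diff_right [of x 0 0] by simp

lemma cinner_scaleR_left: "cinner (r *\<^sub>R x) y = r * cinner x (y::'a::complex_hilbert)"
  by (simp add: scaleR_scaleC cinner_scaleC_left)

lemma cinner_scaleR_right: "cinner x (r *\<^sub>R y) = r * cinner x (y::'a::complex_hilbert)"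
  by (simp add: scaleR_scaleC cinner_scaleC_right)

lemmas cinner_simps = cinner_add_left cinner_add_right cinner_scaleC_left cinner_scaleC_right
  cinner_minus_left cinner_minus_right cinner_diff_left cinner_diff_right
  cinner_scaleR_left cinner_scaleR_right

lemma norm_eq_Re_cinner: "(norm x)\<^sup>2 = Re (cinner x (x::'a::complex_hilbert))"
  by (simp add: cinner_self)

lemma cinner_self_eq_0: "cinner x x = 0 \<longleftrightarrow> (x::'a::complex_hilbert) = 0"
  by (simp add: cinner_self)

lemma cinner_ext: "(\<And>z. cinner x z = cinner y z) \<Longrightarrow> x = (y::'a::complex_hilbert)"
  using cinner_self_eq_0 [of "x - y"] by (simp add: cinner_diff_left)

section \<open>Polarization, continuity and testing on dense sets\<close>

lemma norm_add_square:
  "(norm (x + y))\<^sup>2 = (norm x)\<^sup>2 + 2 * Re (cinner x y) + (norm (y::'a::complex_hilbert))\<^sup>2"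
proof -
  have "Re (cinner y x) = Re (cinner x y)"
    by (subst cinner_commute) simp
  then show ?thesis
    by (simp add: norm_eq_Re_cinner cinner_simps)
qed

lemma norm_diff_square:
  "(norm (x - y))\<^sup>2 = (norm x)\<^sup>2 - 2 * Re (cinner x y) + (norm (y::'a::complex_hilbert))\<^sup>2"
  using norm_add_square [of x "- y"] by (simp add: cinner_minus_right)

text \<open>With \<open>y\<close> fixed, only norms of translates of \<open>x\<close> occur, so
  continuity in the first argument reduces to continuity of the norm.\<close>

lemma cinner_polarization:
  "cinner x (y::'a::complex_hilbert) =
     Complex (((norm (x + y))\<^sup>2 - (norm (x - y))\<^sup>2) / 4)
       (((norm (x + \<i> *\<^sub>C y))\<^sup>2 - (norm (x - \<i> *\<^sub>C y))\<^sup>2) / 4)"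
  by (simp add: norm_add_square norm_diff_square cinner_scaleC_right complex_eq_iff)

lemma continuous_on_cinner_left: "continuous_on UNIV (\<lambda>x. cinner x (y::'a::complex_hilbert))"
  unfolding cinner_polarization Complex_eq by (intro continuous_intros) simp_all

lemma tendsto_cinner_left:
  "(f \<longlongrightarrow> l) F \<Longrightarrow> ((\<lambda>x. cinner (f x) (y::'a::complex_hilbert)) \<longlongrightarrow> cinner l y) F"
  unfolding cinner_polarization Complex_eq by (intro tendsto_intros) simp_all

text \<open>The vectors orthogonal to \<open>w\<close> form a closed set; once it contains
  \<open>D\<close> it is everything, and \<open>w\<close> is orthogonal to itself.\<close>

lemma orthogonal_dense_eq_0:
  assumes "closure D = UNIV" and "\<And>x. x \<in> D \<Longrightarrow> cinner x w = 0"
  shows "w = (0::'a::complex_hilbert)"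
proof -
  have "closed {x. cinner x w = 0}"
    using continuous_on_cinner_left by (intro closed_Collect_eq continuous_on_const) auto
  then have "closure D \<subseteq> {x. cinner x w = 0}"
    using assms(2) by (intro closure_minimal) auto
  then show ?thesis
    using assms(1) cinner_self_eq_0 by blast
qed

section \<open>Nearest points and orthogonal complements of closed subspaces\<close>

lemma exists_closest_point_subspace:
  fixes x :: "'a::complex_hilbert"
  assumes sub: "complex_vector.subspace M" and "closed M"
  shows "\<exists>m\<in>M. \<forall>m'\<in>M. norm (x - m) \<le> norm (x - m')"
proof -
  define d where "d = (INF m\<in>M. (norm (x - m))\<^sup>2)"
  have ne: "M \<noteq> {}"
    using complex_vector.subspace_0 [OF sub] by auto
  have bdd: "bdd_below ((\<lambda>m. (norm (x - m))\<^sup>2) ` M)"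
    by (intro bdd_belowI2 [where m = 0]) simp
  have d_le: "d \<le> (norm (x - m))\<^sup>2" if "m \<in> M" for m
    unfolding d_def using bdd that by (rule cINF_lower)
  have "\<exists>m\<in>M. (norm (x - m))\<^sup>2 < d + 1 / real (Suc n)" for n
    using cINF_less_iff [OF ne bdd, of "d + 1 / real (Suc n)"] unfolding d_def by simp
  then obtain s where sM: "\<And>n. s n \<in> M" and s: "\<And>n. (norm (x - s n))\<^sup>2 < d + 1 / real (Suc n)"
    by metis
  \<comment> \<open>Parallelogram law: the midpoint of \<open>s n\<close> and \<open>s k\<close>
    lies in \<open>M\<close>, hence is at squared distance at least \<open>d\<close> from
    \<open>x\<close>. This makes the minimizing sequence Cauchy.\<close>
  have par: "(norm (s n - s k))\<^sup>2 \<le> 2 / real (Suc n) + 2 / real (Suc k)" for n k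
  proof -
    have "(1/2) *\<^sub>R (s n + s k) \<in> M"
      unfolding scaleR_scaleC
      using sM complex_vector.subspace_add [OF sub] complex_vector.subspace_scale [OF sub]
      by blast
    then have "d \<le> (norm (x - (1/2) *\<^sub>R (s n + s k)))\<^sup>2"
      by (rule d_le)
    also have "x - (1/2) *\<^sub>R (s n + s k) = (1/2) *\<^sub>R ((x - s n) + (x - s k))"
      by (simp add: algebra_simps flip: scaleR_add_left)
    finally have "4 * d \<le> (norm ((x - s n) + (x - s k)))\<^sup>2"
      by (simp add: power_divide)
    moreover have "(norm (s n - s k))\<^sup>2 = (norm ((x - s k) - (x - s n)))\<^sup>2"
      by simp
    ultimately show ?thesis
      using s [of n] s [of k] norm_diff_square [of "x - s k" "x - s n"]
        norm_add_square [of "x - s k" "x - s n"]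
      by (simp add: add.commute)
  qed
  have "Cauchy s"
  proof (rule metric_CauchyI)
    fix e :: real assume "e > 0"
    \<comment> \<open>Each of the two terms in \<open>par\<close> is then below
      \<open>e\<^sup>2 / 2\<close>.\<close>
    then obtain N where N: "inverse (real (Suc N)) < e\<^sup>2 / 4"
      using reals_Archimedean [of "e\<^sup>2 / 4"] by auto
    show "\<exists>N. \<forall>n\<ge>N. \<forall>k\<ge>N. dist (s n) (s k) < e"
    proof (intro exI allI impI)
      fix n k assume "n \<ge> N" "k \<ge> N"
      then have "2 / real (Suc n) \<le> 2 / real (Suc N)" "2 / real (Suc k) \<le> 2 / real (Suc N)"
        by (simp_all add: frac_le)
      then have "(norm (s n - s k))\<^sup>2 < e\<^sup>2"
        using par [of n k] N by (simp add: inverse_eq_divide)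
      then show "dist (s n) (s k) < e"
        using \<open>e > 0\<close> by (simp add: dist_norm power2_less_imp_less)
    qed
  qed
  then obtain m where lim: "s \<longlonglongrightarrow> m"
    using Cauchy_convergent_iff convergent_def by blast
  have "m \<in> M"
    using \<open>closed M\<close> sM lim closed_sequentially by blast
  have "(\<lambda>n. (norm (x - s n))\<^sup>2) \<longlonglongrightarrow> (norm (x - m))\<^sup>2"
    by (intro tendsto_intros lim)
  moreover have "(\<lambda>n. d + 1 / real (Suc n)) \<longlonglongrightarrow> d + 0"
    by (intro tendsto_intros LIMSEQ_Suc [OF lim_1_over_n])
  ultimately have "(norm (x - m))\<^sup>2 \<le> d + 0"
    by (rule LIMSEQ_le) (use s less_imp_le in blast)
  then have "norm (x - m) \<le> norm (x - m')" if "m' \<in> M" for m'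
    using d_le [OF that] by (auto intro: power2_le_imp_le [OF order_trans])
  with \<open>m \<in> M\<close> show ?thesis
    by blast
qed

text \<open>The difference between \<open>x\<close> and its nearest point in \<open>M\<close> is
  orthogonal to \<open>M\<close>, so \<open>perp\<close> makes it vanish.\<close>

lemma closed_subspace_eq_UNIV:
  fixes M :: "'a::complex_hilbert set"
  assumes sub: "complex_vector.subspace M" and "closed M"
    and perp: "\<And>h. (\<And>m. m \<in> M \<Longrightarrow> cinner h m = 0) \<Longrightarrow> h = 0"
  shows "M = UNIV"
proof -
  have "x \<in> M" for x
  proof -
    obtain m where m: "m \<in> M" and min: "\<And>m'. m' \<in> M \<Longrightarrow> norm (x - m) \<le> norm (x - m')"
      using exists_closest_point_subspace [OF sub \<open>closed M\<close>, of x] by blast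
    have Re0: "Re (cinner (x - m) v) = 0" if "v \<in> M" for v
    proof (cases "v = 0")
      case False
      \<comment> \<open>The real \<open>t\<close> that minimizes the norm of
        \<open>(x - m) - t *\<^sub>R v\<close>; it lowers the square by
        \<open>t\<^sup>2 * (norm v)\<^sup>2\<close>, which minimality of \<open>m\<close> forces to
        be zero.\<close>
      define t where "t = Re (cinner (x - m) v) / (norm v)\<^sup>2"
      have t: "Re (cinner (x - m) v) = t * (norm v)\<^sup>2"
        using False by (simp add: t_def)
      have "m + t *\<^sub>R v \<in> M"
        unfolding scaleR_scaleC
        using m that complex_vector.subspace_add [OF sub] complex_vector.subspace_scale [OF sub]
        by blast
      then have "(norm (x - m))\<^sup>2 \<le> (norm ((x - m) - t *\<^sub>R v))\<^sup>2"
        using min [of "m + t *\<^sub>R v"] by (simp add: power_mono diff_diff_add)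
      also have "\<dots> = (norm (x - m))\<^sup>2 - t\<^sup>2 * (norm v)\<^sup>2"
        unfolding norm_diff_square [of "x - m"] cinner_scaleR_right norm_scaleR
        by (simp add: t power_mult_distrib) (simp add: power2_eq_square)
      finally have "(t * norm v)\<^sup>2 \<le> 0"
        by (simp add: power_mult_distrib)
      then have "t * norm v = 0"
        by simp
      with t show ?thesis
        by (simp add: power2_eq_square)
    qed simp
    \<comment> \<open>The real part at \<open>\<i> *\<^sub>C v\<close> is the imaginary part at
      \<open>v\<close>.\<close>
    have "cinner (x - m) v = 0" if "v \<in> M" for v
      using Re0 [OF that] Re0 [OF complex_vector.subspace_scale [OF sub that, of \<i>]]
      by (simp add: cinner_scaleC_right complex_eq_iff)
    then have "x - m = 0"
      by (rule perp)
    with m show ?thesis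
      by simp
  qed
  then show ?thesis
    by blast
qed

section \<open>Unitary operators as self-orthogonal relations\<close>

text \<open>The orthogonal complement of \<open>C\<close> for the indefinite form (a, c) - (b, d) on
  pairs. Its fixed points are the relations equal to their own complement.\<close>

definition isometric_companion ::
    "('a::complex_hilbert \<times> 'a) set \<Rightarrow> ('a \<times> 'a) set" where
  "isometric_companion C = {(a, b). \<forall>(c, d)\<in>C. cinner a c = cinner b d}"

text \<open>A companion pair (a, b) satisfies (b, U c) = (a, c) = (U a, U c) for all c; as
  \<open>U\<close> is onto, b = U a.\<close>

lemma isometric_companion_graph_of_unitary:
  assumes "unitary U"
  shows "isometric_companion (graph_of U) = graph_of U"
proof -
  have iso: "cinner (U x) (U y) = cinner x y" for x y
    using assms by (simp add: unitary_def)
  have "b = U a" if "\<And>c. cinner a c = cinner b (U c)" for a b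
  proof (rule cinner_ext)
    fix z
    obtain c where "z = U c"
      using assms unfolding unitary_def by (metis surjD)
    then show "cinner b z = cinner (U a) z"
      using that iso by simp
  qed
  then show ?thesis
    using iso by (auto simp: isometric_companion_def graph_of_def)
qed

text \<open>The defining equation is symmetric in the two components. This lets the result on
  domains be applied to ranges.\<close>

lemma isometric_companion_converse: "isometric_companion (C\<inverse>) = (isometric_companion C)\<inverse>"
  unfolding isometric_companion_def Ball_def by (simp add: set_eq_iff split_paired_all) metis

text \<open>
  The domain is closed because the relation is closed and isometric. A vector \<open>h\<close> orthogonal to
  the domain gives a pair \<open>(h, 0)\<close> in the relation, which forces \<open>h = 0\<close>.
\<close>

lemma Domain_isometric_companion_fixed:
  fixes C :: "('a::complex_hilbert \<times> 'a) set"
  assumes "isometric_companion C = C"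
  shows "Domain C = UNIV"
proof (rule closed_subspace_eq_UNIV)
  have mem: "(a, b) \<in> C \<longleftrightarrow> (\<forall>(c, d)\<in>C. cinner a c = cinner b d)" for a b
    using assms unfolding isometric_companion_def by blast
  have add: "(a + a', b + b') \<in> C" if "(a, b) \<in> C" "(a', b') \<in> C" for a a' b b'
    using that by (auto simp: mem [of "a + a'"] mem [of a] mem [of a'] cinner_add_left split: prod.splits)
  have scale: "(c *\<^sub>C a, c *\<^sub>C b) \<in> C" if "(a, b) \<in> C" for a b c
    using that by (auto simp: mem [of "c *\<^sub>C a"] mem [of a] cinner_scaleC_left split: prod.splits)
  have zero: "(0, 0) \<in> C"
    by (subst mem) simp
  have norm_eq: "norm b = norm a" if "(a, b) \<in> C" for a b
  proof -
    have "cinner a a = cinner b b"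
      using that mem by blast
    then have "(norm a)\<^sup>2 = (norm b)\<^sup>2"
      by (simp add: norm_eq_Re_cinner)
    then show ?thesis
      by simp
  qed
  show "complex_vector.subspace (Domain C)"
    by (rule complex_vector.subspaceI) (use zero add scale in blast)+
  show "closed (Domain C)"
    unfolding closed_sequential_limits
  proof (intro allI impI)
    fix s l assume *: "(\<forall>n. s n \<in> Domain C) \<and> s \<longlonglongrightarrow> l"
    then have "\<forall>n. \<exists>b. (s n, b) \<in> C"
      by blast
    then obtain t where t: "\<And>n. (s n, t n) \<in> C"
      by metis
    have "dist (t n) (t k) = dist (s n) (s k)" for n k
    proof -
      have "(s n + (-1) *\<^sub>C s k, t n + (-1) *\<^sub>C t k) \<in> C"
        using t by (intro add scale)
      from norm_eq [OF this] show ?thesis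
        by (simp add: dist_norm)
    qed
    moreover have "Cauchy s"
      using * by (auto intro: LIMSEQ_imp_Cauchy)
    ultimately have "Cauchy t"
      by (simp add: Cauchy_def)
    then obtain r where r: "t \<longlonglongrightarrow> r"
      using Cauchy_convergent_iff convergent_def by blast
    have "cinner l c = cinner r d" if "(c, d) \<in> C" for c d
    proof (rule LIMSEQ_unique)
      show "(\<lambda>n. cinner (s n) c) \<longlonglongrightarrow> cinner l c"
        using * by (intro tendsto_cinner_left) simp
      have "cinner (s n) c = cinner (t n) d" for n
        using t [of n] that mem [of "s n"] by blast
      then show "(\<lambda>n. cinner (s n) c) \<longlonglongrightarrow> cinner r d"
        using tendsto_cinner_left [OF r, of d] by simp
    qed
    then have "(l, r) \<in> C"
      by (auto simp: mem [of l])
    then show "l \<in> Domain C"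
      by blast
  qed
  show "h = 0" if h: "\<And>m. m \<in> Domain C \<Longrightarrow> cinner h m = 0" for h
  proof -
    have "(h, 0) \<in> C"
      using h by (subst mem) auto
    then show ?thesis
      using norm_eq [of h 0] by simp
  qed
qed

text \<open>Domain and range are the whole space, and any two pairs of \<open>C\<close> have equal
  inner products of their components. Testing against the full range then yields single-valuedness
  and linearity, neither of which is assumed of \<open>C\<close>.\<close>

lemma isometric_companion_fixed_imp_unitary:
  fixes C :: "('a::complex_hilbert \<times> 'a) set"
  assumes fixed: "isometric_companion C = C"
  shows "\<exists>U. unitary U \<and> C = graph_of U"
proof -
  have iso: "cinner a c = cinner b d" if "(a, b) \<in> C" "(c, d) \<in> C" for a b c d
    using that fixed unfolding isometric_companion_def by blast
  have dom: "Domain C = UNIV"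
    using fixed by (rule Domain_isometric_companion_fixed)
  have ran: "Range C = UNIV"
    using Domain_isometric_companion_fixed [of "C\<inverse>"] fixed
    by (simp add: isometric_companion_converse)
  have "\<forall>a. \<exists>b. (a, b) \<in> C"
    using dom by blast
  then obtain U where U: "\<And>a. (a, U a) \<in> C"
    by metis
  have uniq: "b = U a" if "(a, b) \<in> C" for a b
  proof (rule cinner_ext)
    fix z
    obtain c where "(c, z) \<in> C"
      using ran by blast
    then show "cinner b z = cinner (U a) z"
      using iso that U by metis
  qed
  then have graph: "C = graph_of U"
    using U by (auto simp: graph_of_def)
  have surj: "surj U"
    using ran uniq by (metis RangeE UNIV_I surjI surj_def)
  have inner: "cinner (U x) (U y) = cinner x y" for x y
    using iso [OF U U] by simp
  have eqI: "u = v" if "\<And>y. cinner u (U y) = cinner v (U y)" for u v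
    using that surj by (metis cinner_ext surjD)
  have add: "U (x + y) = U x + U y" for x y
    by (rule eqI) (simp add: cinner_add_left inner)
  have scale: "U (c *\<^sub>C x) = c *\<^sub>C U x" for c x
    by (rule eqI) (simp add: cinner_scaleC_left inner)
  have "norm (U x) = norm x" for x
  proof -
    have "(norm (U x))\<^sup>2 = (norm x)\<^sup>2"
      by (simp add: norm_eq_Re_cinner inner)
    then show ?thesis
      by simp
  qed
  then have "bounded_linear U"
    by (intro bounded_linear_intro [where K = 1]) (simp_all add: add scale scaleR_scaleC)
  then have "unitary U"
    using surj inner scale by (simp add: unitary_def bounded_clinear_def)
  with graph show ?thesis
    by blast
qed

section \<open>The Clifford algebra of two anti-commuting fundamental symmetries\<close>

lemma fundamental_symmetryD:
  assumes "fundamental_symmetry K"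
  shows "K (x + y) = K x + K y" "K (x - y) = K x - K y" "K (- x) = - K x"
    "K (r *\<^sub>R x) = r *\<^sub>R K x" "K (c *\<^sub>C x) = c *\<^sub>C K x"
    "cinner (K x) y = cinner x (K y)" "K (K x) = x"
proof -
  have K: "bounded_linear K"
    using assms by (simp add: fundamental_symmetry_def bounded_clinear_def)
  show "K (x + y) = K x + K y" "K (x - y) = K x - K y" "K (- x) = - K x" "K (r *\<^sub>R x) = r *\<^sub>R K x"
    using linear_simps [OF K] by blast+
  show "K (c *\<^sub>C x) = c *\<^sub>C K x" "cinner (K x) y = cinner x (K y)" "K (K x) = x"
    using assms by (simp_all add: fundamental_symmetry_def bounded_clinear_def)
qed

lemma norm_scaleC: "norm (c *\<^sub>C x) = norm c * norm (x::'a::complex_hilbert)"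
proof -
  have "cinner (c *\<^sub>C x) (c *\<^sub>C x) = (c * cnj c) * cinner x x"
    by (simp add: cinner_scaleC_left cinner_scaleC_right)
  then have "(norm (c *\<^sub>C x))\<^sup>2 = (norm c * norm x)\<^sup>2"
    unfolding cinner_self complex_norm_square [symmetric] of_real_mult [symmetric] of_real_eq_iff
    by (simp add: power_mult_distrib)
  then show ?thesis
    by (simp add: power2_eq_iff_nonneg)
qed

lemma bounded_linear_scaleC: "bounded_linear (\<lambda>x. c *\<^sub>C (x::'a::complex_hilbert))"
  by (rule bounded_linear_intro [where K = "norm c"])
    (simp_all add: scaleC_add_right scaleR_scaleC norm_scaleC mult.commute)

lemma clifford_add: "clifford J R (u + v) x = clifford J R u x + clifford J R v x"
  by (simp add: clifford_def scaleR_add_left)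

lemma clifford_minus: "clifford J R (- v) x = - clifford J R v x"
  by (simp add: clifford_def)

lemma clifford_zero: "clifford J R 0 x = 0"
  by (simp add: clifford_def)

lemma clifford_scaleR: "clifford J R (r *\<^sub>R v) x = r *\<^sub>R clifford J R v x"
  by (simp add: clifford_def scaleR_add_right)

text \<open>Serves three pairs: \<open>J\<close>, \<open>R\<close> themselves, the given pair on the
  boundary space, and the pair built there to match \<open>J\<close>, \<open>R\<close>.\<close>

locale clifford_pair =
  fixes J R :: "'a::complex_hilbert \<Rightarrow> 'a"
  assumes J: "fundamental_symmetry J" and R: "fundamental_symmetry R"
    and anti: "anticommute J R"
begin

lemmas J_simps = fundamental_symmetryD [OF J]
lemmas R_simps = fundamental_symmetryD [OF R]

lemma RJ: "R (J x) = - J (R x)"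
  using anti by (simp add: anticommute_def)

text \<open>The product formula of the Pauli matrices. The sign of the cross product term is
  reversed because the third generator is i J R rather than -i J R.\<close>

lemma clifford_mult:
  "clifford J R u (clifford J R v x) = (u \<bullet> v) *\<^sub>R x - \<i> *\<^sub>C clifford J R (cross3 u v) x"
proof -
  \<comment> \<open>\<open>J\<close> and \<open>R\<close> permute \<open>x\<close>,
    \<open>a\<close>, \<open>b\<close>, \<open>c\<close> up to sign, so both sides expand into
    combinations of these four vectors.\<close>
  define a b c where "a = J x" "b = R x" "c = J (R x)"
  have "J a = x" "J b = c" "J c = b" "R a = - c" "R b = x" "R c = - a"
    by (simp_all add: a_b_c_def J_simps R_simps RJ)
  then show ?thesis
    unfolding clifford_def cross3_def inner_vec_def
    by (simp add: sum_3 scaleR_scaleC J_simps(1-5) R_simps(1-5) flip: a_b_c_def)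
      (simp add: scaleC_add_right scaleC_add_left complex_vector.scale_right_diff_distrib
        complex_vector.scale_left_diff_distrib algebra_simps)
qed

lemma clifford_scaleC_right: "clifford J R v (c *\<^sub>C x) = c *\<^sub>C clifford J R v x"
  by (simp add: clifford_def J_simps(5) R_simps(5) scaleC_add_right scaleR_scaleC mult.commute)

text \<open>For the generator i J R, the sign from conjugating i cancels the sign from exchanging
  \<open>J\<close> and \<open>R\<close>.\<close>

lemma cinner_clifford: "cinner (clifford J R v x) y = cinner x (clifford J R v y)"
  by (simp add: clifford_def J_simps(6) R_simps(6) cinner_simps RJ)

lemma fundamental_symmetry_clifford:
  assumes "norm v = 1"
  shows "fundamental_symmetry (clifford J R v)"
proof -
  have "bounded_linear J" "bounded_linear R"
    using J R by (auto simp: fundamental_symmetry_def bounded_clinear_def)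
  then have "bounded_linear (clifford J R v)"
    unfolding clifford_def
    by (intro bounded_linear_add bounded_linear_const_scaleR
        bounded_linear_compose [OF bounded_linear_scaleC] bounded_linear_compose [of J R])
  moreover have "v \<bullet> v = 1"
    using assms by (simp add: dot_square_norm)
  then have "clifford J R v (clifford J R v x) = x" for x
    by (simp add: clifford_mult clifford_zero)
  ultimately show ?thesis
    by (simp add: fundamental_symmetry_def bounded_clinear_def clifford_scaleC_right
        cinner_clifford)
qed

lemma clifford_mult_orthogonal:
  assumes "u \<bullet> v = 0"
  shows "\<i> *\<^sub>C clifford J R u (clifford J R v x) = clifford J R (cross3 u v) x"
  using assms by (simp add: clifford_mult)

lemma anticommute_clifford:
  assumes "u \<bullet> v = 0"
  shows "anticommute (clifford J R u) (clifford J R v)"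
  unfolding anticommute_def clifford_mult inner_commute [of v u] cross_skew [of v u] clifford_minus
  using assms by simp

text \<open>The cross product terms cancel in the anticommutator, leaving
  \<open>2 * (u \<bullet> v)\<close> times the identity; one nonzero vector detects this
  factor.\<close>

lemma anticommute_clifford_imp_orthogonal:
  assumes "anticommute (clifford J R u) (clifford J R v)" and "(x::'a) \<noteq> 0"
  shows "u \<bullet> v = 0"
proof -
  have "clifford J R u (clifford J R v x) + clifford J R v (clifford J R u x) = 0"
    using assms(1) by (simp add: anticommute_def)
  then have "(2 * (u \<bullet> v)) *\<^sub>R x = 0"
    unfolding clifford_mult inner_commute [of v u] cross_skew [of v u] clifford_minus
    by (simp add: scaleR_add_left flip: scaleR_2)
  with \<open>x \<noteq> 0\<close> show ?thesis
    by simp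
qed

text \<open>An orthogonal pair \<open>u\<close>, \<open>v\<close> generates
  \<open>cross3 u v\<close> as its third direction, so iterating the construction only changes
  coordinates.\<close>

lemma clifford_clifford:
  assumes "u \<bullet> v = 0"
  shows "clifford (clifford J R u) (clifford J R v) w =
    clifford J R ((w $ 1) *\<^sub>R u + (w $ 2) *\<^sub>R v + (w $ 3) *\<^sub>R cross3 u v)"
proof
  fix x
  show "clifford (clifford J R u) (clifford J R v) w x =
    clifford J R ((w $ 1) *\<^sub>R u + (w $ 2) *\<^sub>R v + (w $ 3) *\<^sub>R cross3 u v) x"
    unfolding clifford_def [of "clifford J R u"] clifford_mult_orthogonal [OF assms]
    by (simp add: clifford_add clifford_scaleR)
qed

end

text \<open>\<open>c i\<close> holds the coordinates of the i-th standard basis vector in the frame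
  \<open>u\<close>, \<open>v\<close>, \<open>cross3 u v\<close>.\<close>

lemma orthonormal_frame_cross3:
  fixes u v :: "real^3"
  assumes "norm u = 1" "norm v = 1" "u \<bullet> v = 0"
  defines "c \<equiv> \<lambda>i. vector [u $ i, v $ i, cross3 u v $ i] :: real^3"
  shows "(c i $ 1) *\<^sub>R u + (c i $ 2) *\<^sub>R v + (c i $ 3) *\<^sub>R cross3 u v = axis i 1"
    and "c i \<bullet> c j = (if i = j then 1 else 0)"
proof -
  have "(norm (cross3 u v))\<^sup>2 = 1"
    using assms norm_cross_dot [of u v] by simp
  then have n: "u \<bullet> u = 1" "v \<bullet> v = 1" "(cross3 u v) \<bullet> (cross3 u v) = 1"
    using assms by (simp_all add: dot_square_norm)
  have o: "u \<bullet> (cross3 u v) = 0" "v \<bullet> (cross3 u v) = 0"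
    by (simp_all add: dot_cross_self)
  define Q :: "real^3^3" where "Q = vector [u, v, cross3 u v]"
  have "Q ** transpose Q = mat 1"
    using n o assms(3)
    by (simp add: vec_eq_iff matrix_matrix_mult_def transpose_def mat_def forall_3 Q_def
        inner_vec_def sum_3 mult.commute)
  \<comment> \<open>The rows of \<open>Q\<close> are the frame and its columns are the
    \<open>c i\<close>; for a square matrix, orthonormal rows give orthonormal columns.\<close>
  then have "transpose Q ** Q = mat 1"
    by (rule matrix_left_right_inverse [THEN iffD1])
  then have "(transpose Q ** Q) $ i $ j = (if i = j then 1 else 0)" for i j
    by (simp add: mat_def)
  then have Q: "u $ i * u $ j + v $ i * v $ j + cross3 u v $ i * cross3 u v $ j = (if i = j then 1 else 0)" for i j
    by (simp add: matrix_matrix_mult_def transpose_def sum_3 Q_def)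
  show "(c i $ 1) *\<^sub>R u + (c i $ 2) *\<^sub>R v + (c i $ 3) *\<^sub>R cross3 u v = axis i 1"
    by (simp add: vec_eq_iff axis_def c_def Q)
  show "c i \<bullet> c j = (if i = j then 1 else 0)"
    by (simp add: inner_vec_def sum_3 c_def Q)
qed

section \<open>Adjoints\<close>

lemma adj_iff: "(y, z) \<in> adj T \<longleftrightarrow> (\<forall>x x'. (x, x') \<in> T \<longrightarrow> cinner x' y = cinner x z)"
  by (auto simp: adj_def)

lemma adj_antimono: "S \<subseteq> T \<Longrightarrow> adj T \<subseteq> adj S"
  unfolding adj_def by blast

lemma adj_zero: "(0, 0) \<in> adj T"
  by (simp add: adj_iff)

lemma adj_add: "(x, x') \<in> adj T \<Longrightarrow> (y, y') \<in> adj T \<Longrightarrow> (x + y, x' + y') \<in> adj T"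
  by (simp add: adj_iff cinner_add_right)

lemma adj_scaleC: "(x, x') \<in> adj T \<Longrightarrow> (c *\<^sub>C x, c *\<^sub>C x') \<in> adj T"
  by (simp add: adj_iff cinner_scaleC_right)

lemma Domain_adj_add: "x \<in> Domain (adj T) \<Longrightarrow> y \<in> Domain (adj T) \<Longrightarrow> x + y \<in> Domain (adj T)"
  using adj_add by blast

lemma Domain_adj_scaleC: "x \<in> Domain (adj T) \<Longrightarrow> c *\<^sub>C x \<in> Domain (adj T)"
  using adj_scaleC by blast

lemma single_valued_adj:
  assumes "densely_defined T"
  shows "single_valued (adj T)"
proof (rule single_valuedI)
  fix y z z' assume "(y, z) \<in> adj T" "(y, z') \<in> adj T"
  then have "cinner x (z - z') = 0" if "x \<in> Domain T" for x
    using that by (auto simp: adj_iff cinner_diff_right)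
  then have "z - z' = 0"
    using assms unfolding densely_defined_def by (rule orthogonal_dense_eq_0 [rotated])
  then show "z = z'"
    by simp
qed

lemma symmetric_operator_subset_adj: "symmetric_operator T \<Longrightarrow> T \<subseteq> adj T"
  by (auto simp: symmetric_operator_def adj_iff)

section \<open>Commutation with symmetries and the Krein space adjoint\<close>

definition leaves_invariant :: "('a \<Rightarrow> 'a) \<Rightarrow> 'a graph \<Rightarrow> bool" where
  "leaves_invariant K T \<longleftrightarrow> (\<forall>x y. (x, y) \<in> T \<longrightarrow> (K x, K y) \<in> T)"

lemma leaves_invariantD: "leaves_invariant K T \<Longrightarrow> (x, y) \<in> T \<Longrightarrow> (K x, K y) \<in> T"
  by (simp add: leaves_invariant_def)

lemma leaves_invariant_of_commute:
  assumes "T \<odot> graph_of K = graph_of K \<odot> T"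
  shows "leaves_invariant K T"
  unfolding leaves_invariant_def
proof (intro allI impI)
  fix x y assume "(x, y) \<in> T"
  then have "(x, K y) \<in> graph_of K \<odot> T"
    by (auto simp: op_prod_def graph_of_def)
  then have "(x, K y) \<in> T \<odot> graph_of K"
    using assms by simp
  then show "(K x, K y) \<in> T"
    by (auto simp: op_prod_def graph_of_def)
qed

lemma leaves_invariant_clifford:
  assumes "linear_operator T" "leaves_invariant J T" "leaves_invariant R T"
  shows "leaves_invariant (clifford J R v) T"
  unfolding leaves_invariant_def clifford_def scaleR_scaleC
proof (intro allI impI)
  fix x y assume xy: "(x, y) \<in> T"
  have add: "(a + b, a' + b') \<in> T" if "(a, a') \<in> T" "(b, b') \<in> T" for a a' b b'
    using assms(1) that by (simp add: linear_operator_def)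
  have scale: "(c *\<^sub>C a, c *\<^sub>C a') \<in> T" if "(a, a') \<in> T" for c a a'
    using assms(1) that by (simp add: linear_operator_def)
  show "(complex_of_real (v $ 1) *\<^sub>C J x + complex_of_real (v $ 2) *\<^sub>C R x
        + complex_of_real (v $ 3) *\<^sub>C \<i> *\<^sub>C J (R x),
      complex_of_real (v $ 1) *\<^sub>C J y + complex_of_real (v $ 2) *\<^sub>C R y
        + complex_of_real (v $ 3) *\<^sub>C \<i> *\<^sub>C J (R y)) \<in> T"
    by (rule add scale leaves_invariantD [OF assms(2)] leaves_invariantD [OF assms(3)] xy)+
qed

lemma leaves_invariant_adj:
  assumes "fundamental_symmetry K" "leaves_invariant K T"
  shows "leaves_invariant K (adj T)"
  unfolding leaves_invariant_def adj_iff
proof (intro allI impI)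
  fix x y z z' assume adj: "\<forall>t t'. (t, t') \<in> T \<longrightarrow> cinner t' x = cinner t y" and "(z, z') \<in> T"
  then have "cinner (K z') x = cinner (K z) y"
    using leaves_invariantD [OF assms(2)] by blast
  then show "cinner z' (K x) = cinner z (K y)"
    by (simp add: fundamental_symmetryD(6) [OF assms(1)])
qed

text \<open>The operator equation compares \<open>(x, K z) \<in> adj A\<close> with
  \<open>(K x, z) \<in> A\<close>; since \<open>K\<close> is an involution, substituting x = K f
  gives the symmetric form.\<close>

lemma krein_selfadjoint_iff:
  assumes "fundamental_symmetry K"
  shows "graph_of K \<odot> adj A = A \<odot> graph_of K \<longleftrightarrow>
    (\<forall>f g. (f, g) \<in> A \<longleftrightarrow> (K f, K g) \<in> adj A)"
proof -
  note KK = fundamental_symmetryD(7) [OF assms]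
  have "(x, z) \<in> graph_of K \<odot> adj A \<longleftrightarrow> (x, K z) \<in> adj A" for x z
    using KK by (auto simp: op_prod_def graph_of_def)
  moreover have "(x, z) \<in> A \<odot> graph_of K \<longleftrightarrow> (K x, z) \<in> A" for x z
    by (auto simp: op_prod_def graph_of_def)
  ultimately have "graph_of K \<odot> adj A = A \<odot> graph_of K \<longleftrightarrow>
      (\<forall>x z. (x, K z) \<in> adj A \<longleftrightarrow> (K x, z) \<in> A)"
    by (simp add: set_eq_iff split_paired_all)
  also have "\<dots> \<longleftrightarrow> (\<forall>f g. (f, g) \<in> A \<longleftrightarrow> (K f, K g) \<in> adj A)"
    using KK by metis
  finally show ?thesis .
qed

section \<open>Boundary triplets\<close>

text \<open>Invariance of \<open>adj S\<close> keeps \<open>K f\<close> and \<open>K' f\<close> in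
  the domain, where the boundary maps are linear and the intertwining can be applied again. Used
  first to pass from the given pair to \<open>J\<close>, \<open>R\<close>, then from these to every
  \<alpha>.\<close>

lemma intertwines_clifford:
  assumes triplet: "boundary_triplet S \<Gamma>\<^sub>0 \<Gamma>\<^sub>1"
    and inv: "leaves_invariant K (adj S)" "leaves_invariant K' (adj S)"
    and L: "intertwines S \<Gamma>\<^sub>0 \<Gamma>\<^sub>1 L K" and L': "intertwines S \<Gamma>\<^sub>0 \<Gamma>\<^sub>1 L' K'"
  shows "intertwines S \<Gamma>\<^sub>0 \<Gamma>\<^sub>1 (clifford L L' v) (clifford K K' v)"
proof -
  let ?D = "Domain (adj S)"
  have dom: "K f \<in> ?D" "K' f \<in> ?D" if "f \<in> ?D" for f
    using that inv unfolding leaves_invariant_def by blast+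
  have comb: "clifford L L' v (\<Gamma> f) = \<Gamma> (clifford K K' v f)"
    if "clinear_on ?D \<Gamma>" and eq: "\<And>f. f \<in> ?D \<Longrightarrow> L (\<Gamma> f) = \<Gamma> (K f)" "\<And>f. f \<in> ?D \<Longrightarrow> L' (\<Gamma> f) = \<Gamma> (K' f)"
      and f: "f \<in> ?D" for \<Gamma> :: "'a \<Rightarrow> 'b" and f
    using that(1) f dom unfolding clinear_on_def clifford_def scaleR_scaleC
    by (simp add: eq Domain_adj_add Domain_adj_scaleC)
  have "clinear_on ?D \<Gamma>\<^sub>0" "clinear_on ?D \<Gamma>\<^sub>1"
    using triplet by (simp_all add: boundary_triplet_def)
  then show ?thesis
    using L L' comb unfolding intertwines_def by simp
qed

text \<open>A single direction \<alpha>: \<open>K\<close> is the Clifford element on the original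
  space, \<open>L\<close> its counterpart on the boundary space.\<close>

locale symmetric_boundary_triplet =
  fixes S :: "'a::complex_hilbert graph" and K :: "'a \<Rightarrow> 'a"
    and \<Gamma>\<^sub>0 \<Gamma>\<^sub>1 :: "'a \<Rightarrow> 'h::complex_hilbert" and L :: "'h \<Rightarrow> 'h"
  assumes dense: "densely_defined S" and sym: "symmetric_operator S"
    and K: "fundamental_symmetry K" and K_inv: "leaves_invariant K S"
    and L: "fundamental_symmetry L"
    and triplet: "boundary_triplet S \<Gamma>\<^sub>0 \<Gamma>\<^sub>1"
    and intertwines: "intertwines S \<Gamma>\<^sub>0 \<Gamma>\<^sub>1 L K"
begin

lemma green:
  "(x, x') \<in> adj S \<Longrightarrow> (y, y') \<in> adj S \<Longrightarrow>
    cinner x' y - cinner x y' = cinner (\<Gamma>\<^sub>1 x) (\<Gamma>\<^sub>0 y) - cinner (\<Gamma>\<^sub>0 x) (\<Gamma>\<^sub>1 y)"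
  using triplet by (simp add: boundary_triplet_def)

lemma boundary_values_surj: "\<exists>f f'. (f, f') \<in> adj S \<and> \<Gamma>\<^sub>0 f = a \<and> \<Gamma>\<^sub>1 f = b"
proof -
  have "(a, b) \<in> (\<lambda>f. (\<Gamma>\<^sub>0 f, \<Gamma>\<^sub>1 f)) ` Domain (adj S)"
    using triplet by (simp add: boundary_triplet_def)
  then show ?thesis
    by blast
qed

lemma boundary_values_linear:
  assumes "(x, x') \<in> adj S" "(y, y') \<in> adj S"
  shows "\<Gamma>\<^sub>0 (x + y) = \<Gamma>\<^sub>0 x + \<Gamma>\<^sub>0 y" "\<Gamma>\<^sub>1 (x + y) = \<Gamma>\<^sub>1 x + \<Gamma>\<^sub>1 y"
    "\<Gamma>\<^sub>0 (c *\<^sub>C x) = c *\<^sub>C \<Gamma>\<^sub>0 x" "\<Gamma>\<^sub>1 (c *\<^sub>C x) = c *\<^sub>C \<Gamma>\<^sub>1 x"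
proof -
  have "x \<in> Domain (adj S)" "y \<in> Domain (adj S)"
    using assms by auto
  then show "\<Gamma>\<^sub>0 (x + y) = \<Gamma>\<^sub>0 x + \<Gamma>\<^sub>0 y" "\<Gamma>\<^sub>1 (x + y) = \<Gamma>\<^sub>1 x + \<Gamma>\<^sub>1 y"
    "\<Gamma>\<^sub>0 (c *\<^sub>C x) = c *\<^sub>C \<Gamma>\<^sub>0 x" "\<Gamma>\<^sub>1 (c *\<^sub>C x) = c *\<^sub>C \<Gamma>\<^sub>1 x"
    using triplet unfolding boundary_triplet_def clinear_on_def by blast+
qed

text \<open>For \<open>x\<close> in the domain of \<open>S\<close> the left side of Green's identity
  vanishes against every \<open>y\<close>, while the boundary values of \<open>y\<close> are
  arbitrary; suitable choices leave the squared norm of each boundary value of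
  \<open>x\<close>.\<close>

lemma boundary_values_eq_0:
  assumes "(x, x') \<in> S"
  shows "\<Gamma>\<^sub>0 x = 0" "\<Gamma>\<^sub>1 x = 0"
proof -
  have x: "(x, x') \<in> adj S"
    using assms symmetric_operator_subset_adj [OF sym] by blast
  have eq: "cinner (\<Gamma>\<^sub>1 x) a = cinner (\<Gamma>\<^sub>0 x) b" for a b
  proof -
    obtain y y' where y: "(y, y') \<in> adj S" "\<Gamma>\<^sub>0 y = a" "\<Gamma>\<^sub>1 y = b"
      using boundary_values_surj by blast
    then have "cinner x' y = cinner x y'"
      using assms by (simp add: adj_iff)
    then show ?thesis
      using green [OF x y(1)] y by simp
  qed
  show "\<Gamma>\<^sub>0 x = 0" "\<Gamma>\<^sub>1 x = 0"
    using eq [of 0 "\<Gamma>\<^sub>0 x"] eq [of "\<Gamma>\<^sub>1 x" 0] cinner_self_eq_0 by auto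
qed

section \<open>Extensions as relations on the boundary space\<close>

definition P :: "'a \<Rightarrow> 'h" where
  "P f = L (\<Gamma>\<^sub>1 f) + \<i> *\<^sub>C \<Gamma>\<^sub>0 f"

definition M :: "'a \<Rightarrow> 'h" where
  "M f = L (\<Gamma>\<^sub>1 f) - \<i> *\<^sub>C \<Gamma>\<^sub>0 f"

definition boundary_relation :: "'a graph \<Rightarrow> ('h \<times> 'h) set" where
  "boundary_relation A = (\<lambda>(f, g). (P f, M f)) ` A"

definition restrict_boundary :: "('h \<times> 'h) set \<Rightarrow> 'a graph" where
  "restrict_boundary C = {(f, g) \<in> adj S. (P f, M f) \<in> C}"

lemma boundary_restriction_eq: "boundary_restriction S \<Gamma>\<^sub>0 \<Gamma>\<^sub>1 L U = restrict_boundary (graph_of U)"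
  by (auto simp: boundary_restriction_def restrict_boundary_def graph_of_def P_def M_def)

text \<open>No pair of \<open>C\<close> is lost because \<open>P\<close> and \<open>M\<close> take
  arbitrary joint values. Distinct relations therefore give distinct restrictions.\<close>

lemma boundary_relation_restrict: "boundary_relation (restrict_boundary C) = C"
proof -
  have ex: "\<exists>f g. (f, g) \<in> adj S \<and> P f = a \<and> M f = b" for a b
  proof -
    \<comment> \<open>Solves P f = a, M f = b: the difference is twice i
      \<open>\<Gamma>\<^sub>0 f\<close>, the sum twice \<open>L (\<Gamma>\<^sub>1 f)\<close>, and
      \<open>L\<close> is its own inverse.\<close>
    obtain f g where f: "(f, g) \<in> adj S" "\<Gamma>\<^sub>0 f = (- \<i> / 2) *\<^sub>C (a - b)" "\<Gamma>\<^sub>1 f = L ((1/2) *\<^sub>C (a + b))"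
      using boundary_values_surj by blast
    have half: "(1/2) *\<^sub>C (c + c) = c" for c :: 'h
      unfolding scaleC_add_right scaleC_add_left [symmetric] by simp
    have "(1/2) *\<^sub>C (a + b) + (1/2) *\<^sub>C (a - b) = (1/2) *\<^sub>C (a + a)"
      unfolding scaleC_add_right [symmetric] by simp
    moreover have "(1/2) *\<^sub>C (a + b) - (1/2) *\<^sub>C (a - b) = (1/2) *\<^sub>C (b + b)"
      unfolding complex_vector.scale_right_diff_distrib [symmetric] by simp
    ultimately have "P f = a" "M f = b"
      unfolding P_def M_def f(2,3) fundamental_symmetryD(7) [OF L] scaleC_scaleC
      using half by simp_all
    with f(1) show ?thesis
      by blast
  qed
  have "(a, b) \<in> boundary_relation (restrict_boundary C)" if "(a, b) \<in> C" for a b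
  proof -
    from that obtain f g where "(f, g) \<in> restrict_boundary C" "P f = a" "M f = b"
      using ex [of a b] by (auto simp: restrict_boundary_def)
    then show ?thesis
      unfolding boundary_relation_def by force
  qed
  moreover have "boundary_relation (restrict_boundary C) \<subseteq> C"
    by (auto simp: boundary_relation_def restrict_boundary_def)
  ultimately show ?thesis
    by auto
qed

text \<open>Replacing \<open>y\<close> by \<open>K y\<close> applies \<open>L\<close> to its
  boundary values. On the right the diagonal terms cancel and only the mixed ones survive.\<close>

lemma green_P_M:
  assumes "(x, x') \<in> adj S" "(y, y') \<in> adj S"
  shows "cinner x' (K y) - cinner x (K y') = (\<i> / 2) * (cinner (P x) (P y) - cinner (M x) (M y))"
proof -
  have "(K y, K y') \<in> adj S"
    using leaves_invariant_adj [OF K K_inv] assms(2) by (rule leaves_invariantD)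
  moreover have "\<Gamma>\<^sub>0 (K y) = L (\<Gamma>\<^sub>0 y)" "\<Gamma>\<^sub>1 (K y) = L (\<Gamma>\<^sub>1 y)"
    using intertwines assms(2) unfolding intertwines_def by (metis Domain.DomainI)+
  ultimately have "cinner x' (K y) - cinner x (K y') =
      cinner (\<Gamma>\<^sub>1 x) (L (\<Gamma>\<^sub>0 y)) - cinner (\<Gamma>\<^sub>0 x) (L (\<Gamma>\<^sub>1 y))"
    using green [OF assms(1)] by simp
  then show ?thesis
    by (simp add: P_def M_def cinner_simps fundamental_symmetryD(6) [OF L] algebra_simps)
qed

text \<open>The arguments are exchanged on the right to match \<open>isometric_companion\<close>,
  where the candidate pair stands first.\<close>

lemma krein_orthogonal_iff:
  assumes "(x, x') \<in> adj S" "(y, y') \<in> adj S"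
  shows "cinner x' (K y) = cinner x (K y') \<longleftrightarrow> cinner (P y) (P x) = cinner (M y) (M x)"
proof -
  have "cinner x' (K y) = cinner x (K y') \<longleftrightarrow> cinner (P x) (P y) = cinner (M x) (M y)"
    using green_P_M [OF assms]
    by (metis divide_eq_0_iff complex_i_not_zero mult_eq_0_iff right_minus_eq zero_neq_numeral)
  also have "\<dots> \<longleftrightarrow> cinner (P y) (P x) = cinner (M y) (M x)"
    by (metis cinner_commute)
  finally show ?thesis .
qed

text \<open>The left side is the graph of the Krein space adjoint \<open>K\<close>
  \<open>adj A\<close> \<open>K\<close>. By the twisted Green identity, forming it amounts to
  forming the companion of the boundary relation.\<close>

lemma krein_adjoint_eq_restrict:
  assumes "S \<subseteq> A" "A \<subseteq> adj S"
  shows "{(f, g). (K f, K g) \<in> adj A} = restrict_boundary (isometric_companion (boundary_relation A))"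
proof -
  have "(K f, K g) \<in> adj A \<longleftrightarrow> (f, g) \<in> restrict_boundary (isometric_companion (boundary_relation A))" for f g
  proof (cases "(f, g) \<in> adj S")
    case True
    then have "(K f, K g) \<in> adj A \<longleftrightarrow>
        (\<forall>(x, x')\<in>A. cinner (P f) (P x) = cinner (M f) (M x))"
      unfolding adj_iff [of _ _ A] using assms(2) krein_orthogonal_iff [OF _ True] by blast
    with True show ?thesis
      by (auto simp: restrict_boundary_def isometric_companion_def boundary_relation_def)
  next
    case False
    \<comment> \<open>Outside \<open>adj S\<close> both sides fail: \<open>adj A\<close> is
      contained in \<open>adj S\<close>, which is invariant under the involution
      \<open>K\<close>.\<close>
    have "(K f, K g) \<notin> adj S"
      using False leaves_invariantD [OF leaves_invariant_adj [OF K K_inv], of "K f" "K g"]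
      by (auto simp: fundamental_symmetryD(7) [OF K])
    with False show ?thesis
      using adj_antimono [OF assms(1)] by (auto simp: restrict_boundary_def)
  qed
  then show ?thesis
    by auto
qed

lemma krein_selfadjoint_iff_restrict:
  assumes "S \<subseteq> A"
  shows "graph_of K \<odot> adj A = A \<odot> graph_of K \<longleftrightarrow>
    A \<subseteq> adj S \<and> A = restrict_boundary (isometric_companion (boundary_relation A))"
proof -
  \<comment> \<open>An extension equal to its Krein adjoint lies in that of \<open>S\<close>, which
    invariance under \<open>K\<close> identifies with \<open>adj S\<close>.\<close>
  have "A \<subseteq> adj S" if "\<forall>f g. (f, g) \<in> A \<longleftrightarrow> (K f, K g) \<in> adj A"
  proof clarify
    fix f g assume "(f, g) \<in> A"
    then have "(K f, K g) \<in> adj S"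
      using that adj_antimono [OF assms] by blast
    then show "(f, g) \<in> adj S"
      using leaves_invariantD [OF leaves_invariant_adj [OF K K_inv], of "K f" "K g"]
      by (simp add: fundamental_symmetryD(7) [OF K])
  qed
  moreover have "(\<forall>f g. (f, g) \<in> A \<longleftrightarrow> (K f, K g) \<in> adj A) \<longleftrightarrow> A = {(f, g). (K f, K g) \<in> adj A}"
    by auto
  ultimately show ?thesis
    unfolding krein_selfadjoint_iff [OF K] using krein_adjoint_eq_restrict [OF assms] by metis
qed

section \<open>The correspondence with unitary operators\<close>

lemma restrict_graph_of_selfadjoint:
  assumes "unitary U"
  shows "restrict_boundary (graph_of U) \<in> selfadjoint_extensions S K"
proof -
  have U: "U (x + y) = U x + U y" "U (c *\<^sub>C x) = c *\<^sub>C U x" for x y c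
    using assms linear_simps(1) unfolding unitary_def bounded_clinear_def by blast+
  have U0: "U 0 = 0"
    using U(2) [of 0 0] by simp
  have L0: "L 0 = 0"
    using fundamental_symmetryD(5) [OF L, of 0 0] by simp
  \<comment> \<open>\<open>P\<close> and \<open>M\<close> vanish on the domain of \<open>S\<close>,
    and the graph of \<open>U\<close> contains (0, 0).\<close>
  have sub: "S \<subseteq> restrict_boundary (graph_of U)"
  proof clarify
    fix x x' assume "(x, x') \<in> S"
    then show "(x, x') \<in> restrict_boundary (graph_of U)"
      using symmetric_operator_subset_adj [OF sym]
      by (auto simp: restrict_boundary_def graph_of_def P_def M_def boundary_values_eq_0 U0 L0)
  qed
  have PM: "P (x + y) = P x + P y" "M (x + y) = M x + M y"
    "P (c *\<^sub>C x) = c *\<^sub>C P x" "M (c *\<^sub>C x) = c *\<^sub>C M x"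
    if "(x, x') \<in> adj S" "(y, y') \<in> adj S" for x x' y y' c
    by (simp_all add: P_def M_def boundary_values_linear [OF that] fundamental_symmetryD(1,5) [OF L]
        scaleC_add_right complex_vector.scale_right_diff_distrib mult.commute)
  have "P 0 = 0" "M 0 = 0"
    using PM(3,4) [OF adj_zero adj_zero, of 0] by simp_all
  moreover have "single_valued (restrict_boundary (graph_of U))"
    using single_valued_adj [OF dense] by (rule single_valued_subset [rotated]) (auto simp: restrict_boundary_def)
  ultimately have "linear_operator (restrict_boundary (graph_of U))"
    unfolding linear_operator_def restrict_boundary_def graph_of_def
    by (auto simp: adj_zero U0 U PM adj_add adj_scaleC)
  moreover have "graph_of K \<odot> adj (restrict_boundary (graph_of U)) = restrict_boundary (graph_of U) \<odot> graph_of K"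
    unfolding krein_selfadjoint_iff_restrict [OF sub] boundary_relation_restrict
      isometric_companion_graph_of_unitary [OF assms]
    by (auto simp: restrict_boundary_def)
  ultimately show ?thesis
    using sub by (simp add: selfadjoint_extensions_def)
qed

lemma selfadjoint_extension_imp_restrict:
  assumes "A \<in> selfadjoint_extensions S K"
  shows "\<exists>U. unitary U \<and> A = restrict_boundary (graph_of U)"
proof -
  have A: "A = restrict_boundary (isometric_companion (boundary_relation A))"
    using assms krein_selfadjoint_iff_restrict unfolding selfadjoint_extensions_def by blast
  \<comment> \<open>Taking the boundary relation of both sides of \<open>A\<close> strips off the
    restriction and leaves the fixed point equation.\<close>
  then have fixed: "isometric_companion (boundary_relation A) = boundary_relation A"
    by (metis boundary_relation_restrict)
  then obtain U where "unitary U" "boundary_relation A = graph_of U"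
    using isometric_companion_fixed_imp_unitary by blast
  then show ?thesis
    using A fixed by auto
qed

lemma bij_betw_boundary_restriction:
  "bij_betw (\<lambda>U. boundary_restriction S \<Gamma>\<^sub>0 \<Gamma>\<^sub>1 L U) {U. unitary U} (selfadjoint_extensions S K)"
  unfolding boundary_restriction_eq
proof (rule bij_betwI')
  fix U V :: "'h \<Rightarrow> 'h"
  have "graph_of U = graph_of V \<Longrightarrow> U = V"
    by (auto simp: graph_of_def set_eq_iff)
  then show "restrict_boundary (graph_of U) = restrict_boundary (graph_of V) \<longleftrightarrow> U = V"
    by (metis boundary_relation_restrict)
qed (use restrict_graph_of_selfadjoint selfadjoint_extension_imp_restrict in auto)

end

section \<open>Transfer from the compatible pair to all directions \<alpha>\<close>

theorem theorem2p14:
  fixes J R :: "'a::complex_hilbert \<Rightarrow> 'a"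
    and S :: "'a graph"
    and \<Gamma>\<^sub>0 \<Gamma>\<^sub>1 :: "'a \<Rightarrow> 'h::complex_hilbert"
  assumes "nontrivial_fundamental_symmetry J"
    and "nontrivial_fundamental_symmetry R"
    and "anticommute J R"
    and "linear_operator S"
    and "closed S"
    and "densely_defined S"
    and "symmetric_operator S"
    and "equal_deficiency_indices S"
    and "S \<odot> graph_of J = graph_of J \<odot> S"
    and "S \<odot> graph_of R = graph_of R \<odot> S"
    and "boundary_triplet S \<Gamma>\<^sub>0 \<Gamma>\<^sub>1"
    and "clifford_compatible J R S \<Gamma>\<^sub>0 \<Gamma>\<^sub>1"
  shows "\<exists>J' R'. induced_symmetries S \<Gamma>\<^sub>0 \<Gamma>\<^sub>1 J R J' R' \<and>
    (\<forall>\<alpha>\<in>sphere 0 1.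
       bij_betw (\<lambda>U. boundary_restriction S \<Gamma>\<^sub>0 \<Gamma>\<^sub>1 (clifford J' R' \<alpha>) U)
         {U. unitary U}
         (selfadjoint_extensions S (clifford J R \<alpha>)))"
proof -
  have J: "fundamental_symmetry J" and R: "fundamental_symmetry R"
    using assms(1,2) by (simp_all add: nontrivial_fundamental_symmetry_def)
  interpret JR: clifford_pair J R
    using J R assms(3) by unfold_locales
  obtain \<tau> \<kappa> L L' where norm: "norm \<tau> = 1" "norm \<kappa> = 1"
    and anti: "anticommute (clifford J R \<tau>) (clifford J R \<kappa>)"
    and ind: "induced_symmetries S \<Gamma>\<^sub>0 \<Gamma>\<^sub>1 (clifford J R \<tau>) (clifford J R \<kappa>) L L'"
    using assms(12) unfolding clifford_compatible_def by auto
  interpret LL': clifford_pair L L'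
    using ind unfolding induced_symmetries_def by unfold_locales auto
  \<comment> \<open>Non-triviality of \<open>J\<close> supplies the nonzero vector needed to read
    orthogonality of \<tau> and \<kappa> off the anticommutation.\<close>
  have "J \<noteq> (\<lambda>x. x)"
    using assms(1) by (simp add: nontrivial_fundamental_symmetry_def)
  then obtain x where "J x \<noteq> x"
    by auto
  then have "J x - x \<noteq> 0"
    by simp
  then have orth: "\<tau> \<bullet> \<kappa> = 0"
    by (rule JR.anticommute_clifford_imp_orthogonal [OF anti])
  define c :: "3 \<Rightarrow> real^3" where "c i = vector [\<tau> $ i, \<kappa> $ i, cross3 \<tau> \<kappa> $ i]" for i
  have c_inner: "c i \<bullet> c j = (if i = j then 1 else 0)" for i j
    unfolding c_def using norm orth by (rule orthonormal_frame_cross3(2))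
  \<comment> \<open>The coefficients \<open>c i\<close> recover the standard generators from the
    pair for \<tau> and \<kappa>.\<close>
  have c_clifford: "clifford (clifford J R \<tau>) (clifford J R \<kappa>) (c i) = clifford J R (axis i 1)" for i
    unfolding JR.clifford_clifford [OF orth] c_def orthonormal_frame_cross3(1) [OF norm orth] ..
  have axes: "clifford J R (axis 1 1) = J" "clifford J R (axis 2 1) = R"
    by (simp_all add: fun_eq_iff clifford_def axis_def)
  have inv: "leaves_invariant (clifford J R v) S" for v
    using assms(4,9,10) by (intro leaves_invariant_clifford leaves_invariant_of_commute)
  have inv_adj: "leaves_invariant (clifford J R v) (adj S)" if "norm v = 1" for v
    using JR.fundamental_symmetry_clifford [OF that] inv by (rule leaves_invariant_adj)
  \<comment> \<open>The same coefficients applied to \<open>L\<close>, \<open>L'\<close> give the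
    boundary counterparts of \<open>J\<close> and \<open>R\<close>; orthonormality of the
    \<open>c i\<close> makes these anticommuting fundamental symmetries.\<close>
  define J' R' where "J' = clifford L L' (c 1)" and "R' = clifford L L' (c 2)"
  have inter: "intertwines S \<Gamma>\<^sub>0 \<Gamma>\<^sub>1 (clifford L L' (c i)) (clifford J R (axis i 1))" for i
    unfolding c_clifford [symmetric] using assms(11) ind inv_adj norm
    by (intro intertwines_clifford) (auto simp: induced_symmetries_def)
  have norm_c: "norm (c i) = 1" for i
    using c_inner [of i i] by (simp add: norm_eq_sqrt_inner)
  have induced: "induced_symmetries S \<Gamma>\<^sub>0 \<Gamma>\<^sub>1 J R J' R'"
    unfolding induced_symmetries_def J'_def R'_def
    using inter [of 1] inter [of 2] LL'.fundamental_symmetry_clifford [OF norm_c]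
      LL'.anticommute_clifford [of "c 1" "c 2"] c_inner [of 1 2]
    by (simp add: axes)
  moreover have "bij_betw (\<lambda>U. boundary_restriction S \<Gamma>\<^sub>0 \<Gamma>\<^sub>1 (clifford J' R' \<alpha>) U)
      {U. unitary U} (selfadjoint_extensions S (clifford J R \<alpha>))"
    if "\<alpha> \<in> sphere 0 1" for \<alpha>
  proof -
    have \<alpha>: "norm \<alpha> = 1"
      using that by simp
    interpret J'R': clifford_pair J' R'
      using induced unfolding induced_symmetries_def by unfold_locales auto
    have "leaves_invariant J (adj S)" "leaves_invariant R (adj S)"
      using inv_adj [of "axis 1 1"] inv_adj [of "axis 2 1"] by (simp_all add: axes norm_axis_1)
    then have "intertwines S \<Gamma>\<^sub>0 \<Gamma>\<^sub>1 (clifford J' R' \<alpha>) (clifford J R \<alpha>)"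
      using assms(11) induced by (intro intertwines_clifford) (auto simp: induced_symmetries_def)
    then interpret symmetric_boundary_triplet S "clifford J R \<alpha>" \<Gamma>\<^sub>0 \<Gamma>\<^sub>1 "clifford J' R' \<alpha>"
      using assms(6,7,11) inv JR.fundamental_symmetry_clifford [OF \<alpha>]
        J'R'.fundamental_symmetry_clifford [OF \<alpha>]
      by unfold_locales
    show ?thesis
      by (rule bij_betw_boundary_restriction)
  qed
  ultimately show ?thesis
    by blast
qed

end
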